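(* Let $F$ and $F^{-1}$ be the transforms defined in the context by $$F[\phi](\lambda)=\begin{cases}\int_0^\infty e^{-i\lambda y}\phi(y)\,dy&\lambda\in\mathbb R,\\ -\frac1{\lambda^2}\int_0^\infty e^{-\frac{i}{\lambda}y}\phi(y)\,dy&\lambda\in\mathcal C,\end{cases}\qquad F^{-1}[f](x)=\frac1{2\pi}\int_{\mathbb R\cup\mathcal C}e^{i\lambda x}f(\lambda)\,d\lambda .$$ Then $F$ and $F^{-1}$ are both linear and, for all $\phi\in\mathcal S[0,\infty)$ and all $x\in(0,\infty)$, $F^{-1}[F[\phi]](x)=\phi(x)$.
   Context: $\mathcal S[0,\infty)$ is the space of (complex valued) smooth functions on $[0,\infty)$ (smooth up to $0$) which decay rapidly at infinity along with all of their derivatives. $\mathcal C$ is a small positively oriented (piecewise smooth) simple closed contour enclosing the point $\lambda=i$; "small" means that $\mathcal C$ lies in the open upper half plane $\mathbb C^+$. The contour $\mathbb R$ is oriented in the increasing sense. $F[\phi]$, for $\phi\in\mathcal S[0,\infty)$, is the function on $\mathbb R\cup\mathcal C$ (disjoint contours) given in the claim, and $\int_{\mathbb R\cup\mathcal C}=\int_{\mathbb R}+\int_{\mathcal C}$, where the integral over $\mathbb R$ is improper, understood as $\lim_{N\to\infty}\int_{-N}^N$. Linearity of $F^{-1}$ is meant on functions $f$ for which this limit and the integral over $\mathcal C$ exist. *)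

theory Defs
  imports "HOL-Complex_Analysis.Complex_Analysis"
begin

(* Elements of S[0,oo) are represented by functions on all of the reals; only their values
   on {0..} matter. At 0 the derivative is one-sided. *)

definition halfline_deriv :: "(real \<Rightarrow> complex) \<Rightarrow> real \<Rightarrow> complex" where
  "halfline_deriv g x = vector_derivative g (at x within {0..})"

definition schwartz_halfline :: "(real \<Rightarrow> complex) set" where
  "schwartz_halfline = {\<phi>.
     (\<forall>k. \<forall>x\<ge>0. (halfline_deriv ^^ k) \<phi> differentiable (at x within {0..})) \<and>
     (\<forall>k n. \<exists>B. \<forall>x\<ge>0. x ^ n * norm ((halfline_deriv ^^ k) \<phi> x) \<le> B)}"

definition admissible_contour :: "(real \<Rightarrow> complex) \<Rightarrow> bool" where
  "admissible_contour \<gamma> \<longleftrightarrow>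
     valid_path \<gamma> \<and> simple_path \<gamma> \<and> pathfinish \<gamma> = pathstart \<gamma> \<and>
     path_image \<gamma> \<subseteq> {z. Im z > 0} \<and>
     \<i> \<in> inside (path_image \<gamma>) \<and>
     (\<forall>z\<in>inside (path_image \<gamma>). winding_number \<gamma> z = 1)"

(* The transform is a function on the union of the real line and the contour; the value 0
   elsewhere is a dummy. *)

definition F_transform :: "(real \<Rightarrow> complex) \<Rightarrow> (real \<Rightarrow> complex) \<Rightarrow> complex \<Rightarrow> complex" where
  "F_transform \<gamma> \<phi> z =
     (if z \<in> \<real> then integral {0..} (\<lambda>y. exp (- \<i> * z * of_real y) * \<phi> y)
      else if z \<in> path_image \<gamma> then
        - (1 / z\<^sup>2) * integral {0..} (\<lambda>y. exp (- (\<i> / z) * of_real y) * \<phi> y)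
      else 0)"

definition F_inverse :: "(real \<Rightarrow> complex) \<Rightarrow> (complex \<Rightarrow> complex) \<Rightarrow> real \<Rightarrow> complex" where
  "F_inverse \<gamma> f x = 1 / (2 * of_real pi) *
     (Lim at_top (\<lambda>N::real. integral {-N..N}
        (\<lambda>l. exp (\<i> * of_real l * of_real x) * f (of_real l))) +
      contour_integral \<gamma> (\<lambda>z. exp (\<i> * z * of_real x) * f z))"

(* The functions f for which both integrals in the formula for F_inverse at x exist, so that
   Lim and contour_integral are not junk values. *)

definition F_inverse_domain :: "(real \<Rightarrow> complex) \<Rightarrow> real \<Rightarrow> (complex \<Rightarrow> complex) set" where
  "F_inverse_domain \<gamma> x = {f.
     (\<forall>N::real. (\<lambda>l. exp (\<i> * of_real l * of_real x) * f (of_real l)) integrable_on {-N..N}) \<and>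
     (\<exists>L. ((\<lambda>N::real. integral {-N..N}
        (\<lambda>l. exp (\<i> * of_real l * of_real x) * f (of_real l))) \<longlongrightarrow> L) at_top) \<and>
     (\<lambda>z. exp (\<i> * z * of_real x) * f z) contour_integrable_on \<gamma>}"

(* T is a complex-linear map from the vector space V of functions to functions on X. *)

definition complex_linear_on ::
  "('a \<Rightarrow> complex) set \<Rightarrow> 'b set \<Rightarrow> (('a \<Rightarrow> complex) \<Rightarrow> 'b \<Rightarrow> complex) \<Rightarrow> bool" where
  "complex_linear_on V X T \<longleftrightarrow>
     (\<lambda>t. 0) \<in> V \<and>
     (\<forall>f\<in>V. \<forall>g\<in>V. \<forall>a b. (\<lambda>t. a * f t + b * g t) \<in> V \<and>
        (\<forall>x\<in>X. T (\<lambda>t. a * f t + b * g t) x = a * T f x + b * T g x))"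

end

theory Submission
  imports Defs "HOL-Probability.Sinc_Integral" "HOL-Real_Asymp.Real_Asymp"
begin

text \<open>The two halves of the contour play very different roles. On the closed curve the transform is
  $-\lambda^{-2}$ times the Laplace transform of \<open>\<phi>\<close> at \<open>\<i> / \<lambda>\<close>. Since \<open>\<lambda> \<mapsto> \<i> / \<lambda>\<close> maps the upper
  half-plane into the right half-plane, where the Laplace transform is holomorphic, the integrand of
  the inverse transform is holomorphic on a convex open set containing the curve, and Cauchy's theorem
  makes this contribution zero (\<open>contour_part_vanishes\<close>).

  What remains is Fourier inversion for a function that may jump at \<open>0\<close>. Its transform decays only
  like \<open>1 / \<lambda>\<close>, so the inversion integral converges conditionally and is analysed through its symmetric
  truncations. Exchanging the integrals gives the Dirichlet integral
  $\int_0^\infty \phi(y)\, 2\sin(N(y-x))/(y-x)\,dy$. The kernel is the derivative of \<open>2 Si(N(y - x))\<close>, where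
  \<open>Si\<close> is the sine integral. Integration by parts moves this derivative to \<open>\<phi>\<close> and gives
  $2\phi(0)\,Si(Nx) - \int_0^\infty 2\,Si(N(y-x))\,\phi'(y)\,dy$ (\<open>fourier_partial_integral_Si\<close>). Now the
  integrand is dominated by a multiple of $|\phi'|$, and \<open>Si(N(y - x))\<close> tends to \<open>\<pi>/2\<close> times the sign
  of \<open>y - x\<close>. The limit is therefore
  $\pi\phi(0) - \pi\int_0^\infty sgn(y-x)\,\phi'(y)\,dy = 2\pi\phi(x)$ (\<open>fourier_inversion_halfline\<close>).

  Linearity holds because all the integrals involved exist and because one-sided derivatives at \<open>0\<close> are
  unique, so that \<open>schwartz_halfline\<close> is a vector space.\<close>

section \<open>Schwartz functions on the half-line\<close>

text \<open>One-sided derivatives are unique only where the filter is proper; this is the case at every point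
  of the half-line, the endpoint included.\<close>
lemma at_within_halfline_nontrivial:
  assumes "x \<ge> (0::real)"
  shows "at x within {0..} \<noteq> bot"
proof -
  have "{0..} \<noteq> {a}" for a :: real
  proof
    assume "{0..} = {a}"
    then have "0 \<in> {a}" "1 \<in> {a}" by (metis atLeast_iff order_refl zero_le_one)+
    then show False by simp
  qed
  then have "x islimpt {0..}"
    using assms by (intro connected_imp_perfect) auto
  then show ?thesis
    by (simp add: trivial_limit_within)
qed

lemma halfline_deriv_works:
  "g differentiable (at x within {0..}) \<Longrightarrow>
     (g has_vector_derivative halfline_deriv g x) (at x within {0..})"
  unfolding halfline_deriv_def by (rule vector_derivative_works[THEN iffD1])

lemma halfline_deriv_eqI:
  assumes "(g has_vector_derivative d) (at x within {0..})" "x \<ge> 0"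
  shows "halfline_deriv g x = d"
  unfolding halfline_deriv_def
  using assms at_within_halfline_nontrivial vector_derivative_within by blast

text \<open>The two conclusions feed each other in the induction on \<open>k\<close>: the value of the next derivative is
  read off from a derivative of the current one. The identity is restricted to \<open>x \<ge> 0\<close> because
  \<open>halfline_deriv\<close> is an arbitrary value at negative points; the restriction is harmless, as a
  derivative within the half-line sees only values there.\<close>
lemma halfline_deriv_iterate_linear:
  assumes f: "\<And>k x. x \<ge> 0 \<Longrightarrow> (halfline_deriv ^^ k) f differentiable (at x within {0..})"
    and g: "\<And>k x. x \<ge> 0 \<Longrightarrow> (halfline_deriv ^^ k) g differentiable (at x within {0..})"
    and x: "x \<ge> 0"
  shows "(halfline_deriv ^^ k) (\<lambda>t. a * f t + b * g t) x
           = a * (halfline_deriv ^^ k) f x + b * (halfline_deriv ^^ k) g x"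
    and "(halfline_deriv ^^ k) (\<lambda>t. a * f t + b * g t) differentiable (at x within {0..})"
proof -
  let ?h = "\<lambda>k. (halfline_deriv ^^ k) (\<lambda>t. a * f t + b * g t)"
  let ?c = "\<lambda>k t. a * (halfline_deriv ^^ k) f t + b * (halfline_deriv ^^ k) g t"
  have step: "(?h k has_vector_derivative ?c (Suc k) x) (at x within {0..})"
    if eq: "\<And>y. y \<ge> 0 \<Longrightarrow> ?h k y = ?c k y" and x: "x \<ge> 0" for k x
  proof (rule has_vector_derivative_transform[where f = "?c k"])
    show "(?c k has_vector_derivative ?c (Suc k) x) (at x within {0..})"
      using halfline_deriv_works[OF f[OF x, of k]] halfline_deriv_works[OF g[OF x, of k]]
      by (auto intro!: derivative_eq_intros has_vector_derivative_mult_right)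
  qed (use x eq in auto)
  have eq: "?h k y = ?c k y" if "y \<ge> 0" for k y
    using that
  proof (induction k arbitrary: y)
    case (Suc k)
    then show ?case
      using halfline_deriv_eqI[OF step[of k y]] by simp
  qed simp
  show "?h k x = ?c k x"
    using eq x by simp
  show "?h k differentiable (at x within {0..})"
    using step[of k x] eq x differentiableI_vector by blast
qed

lemma schwartz_halfline_zero: "(\<lambda>t. 0) \<in> schwartz_halfline"
proof -
  have zero: "(halfline_deriv ^^ k) (\<lambda>t. 0) x = 0" if "x \<ge> 0" for k x
    using that
  proof (induction k arbitrary: x)
    case (Suc k)
    have "((halfline_deriv ^^ k) (\<lambda>t. 0) has_vector_derivative 0) (at x within {0..})"
      by (rule has_vector_derivative_transform[where f = "\<lambda>t. 0"]) (use Suc in auto)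
    then show ?case
      using halfline_deriv_eqI Suc.prems by simp
  qed simp
  have "(halfline_deriv ^^ k) (\<lambda>t. 0) differentiable (at x within {0..})" if "x \<ge> 0" for k x
    by (rule differentiable_transform_within[where f = "\<lambda>t. 0" and d = 1]) (use zero that in auto)
  then show ?thesis
    unfolding schwartz_halfline_def using zero by auto
qed

lemma schwartz_halfline_linear:
  assumes "f \<in> schwartz_halfline" "g \<in> schwartz_halfline"
  shows "(\<lambda>t. a * f t + b * g t) \<in> schwartz_halfline"
proof -
  have f: "\<And>k x. x \<ge> 0 \<Longrightarrow> (halfline_deriv ^^ k) f differentiable (at x within {0..})"
    and g: "\<And>k x. x \<ge> 0 \<Longrightarrow> (halfline_deriv ^^ k) g differentiable (at x within {0..})"
    and Bf: "\<And>k n. \<exists>B. \<forall>x\<ge>0. x ^ n * norm ((halfline_deriv ^^ k) f x) \<le> B"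
    and Bg: "\<And>k n. \<exists>B. \<forall>x\<ge>0. x ^ n * norm ((halfline_deriv ^^ k) g x) \<le> B"
    using assms unfolding schwartz_halfline_def by blast+
  note lin = halfline_deriv_iterate_linear[OF f g]
  have "\<exists>B. \<forall>x\<ge>0. x ^ n * norm ((halfline_deriv ^^ k) (\<lambda>t. a * f t + b * g t) x) \<le> B" for k n
  proof -
    obtain B1 B2 where B: "\<And>x. x \<ge> 0 \<Longrightarrow> x ^ n * norm ((halfline_deriv ^^ k) f x) \<le> B1"
      "\<And>x. x \<ge> 0 \<Longrightarrow> x ^ n * norm ((halfline_deriv ^^ k) g x) \<le> B2"
      using Bf[of n k] Bg[of n k] by blast
    have "x ^ n * norm ((halfline_deriv ^^ k) (\<lambda>t. a * f t + b * g t) x)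
            \<le> norm a * B1 + norm b * B2" if x: "x \<ge> 0" for x
    proof -
      let ?u = "norm ((halfline_deriv ^^ k) f x)" and ?v = "norm ((halfline_deriv ^^ k) g x)"
      have "x ^ n * norm ((halfline_deriv ^^ k) (\<lambda>t. a * f t + b * g t) x)
              \<le> x ^ n * (norm a * ?u + norm b * ?v)"
        using lin(1)[OF _ _ x] x
        by (intro mult_left_mono) (auto intro: norm_triangle_le simp: norm_mult)
      also have "\<dots> = norm a * (x ^ n * ?u) + norm b * (x ^ n * ?v)"
        by (simp add: algebra_simps)
      also have "\<dots> \<le> norm a * B1 + norm b * B2"
        using B x by (intro add_mono mult_left_mono) auto
      finally show ?thesis .
    qed
    then show ?thesis by blast
  qed
  then show ?thesis
    unfolding schwartz_halfline_def using lin(2) by simp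
qed

lemma schwartz_halfline_has_derivative:
  assumes "\<phi> \<in> schwartz_halfline" "x \<ge> 0"
  shows "(\<phi> has_vector_derivative halfline_deriv \<phi> x) (at x within {0..})"
proof -
  have "(halfline_deriv ^^ 0) \<phi> differentiable (at x within {0..})"
    using assms unfolding schwartz_halfline_def by blast
  then show ?thesis
    by (intro halfline_deriv_works) simp
qed

lemma schwartz_halfline_deriv:
  assumes "\<phi> \<in> schwartz_halfline"
  shows "halfline_deriv \<phi> \<in> schwartz_halfline"
proof -
  have "(halfline_deriv ^^ k) (halfline_deriv \<phi>) = (halfline_deriv ^^ Suc k) \<phi>" for k
    by (simp add: funpow_swap1)
  with assms show ?thesis
    unfolding schwartz_halfline_def mem_Collect_eq by presburger
qed

lemma schwartz_halfline_continuous: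
  assumes "\<phi> \<in> schwartz_halfline"
  shows "continuous_on {0..} \<phi>"
  unfolding continuous_on_eq_continuous_within
  using schwartz_halfline_has_derivative[OF assms] has_vector_derivative_continuous
  by (metis atLeast_iff)

text \<open>The seminorms of order \<open>0\<close> and \<open>2\<close> combine to an integrable majorant.\<close>
lemma schwartz_halfline_decay:
  assumes "\<phi> \<in> schwartz_halfline"
  obtains B where "\<And>x. x \<ge> 0 \<Longrightarrow> norm (\<phi> x) \<le> B * inverse (1 + x\<^sup>2)"
proof -
  have "\<And>n. \<exists>B. \<forall>x\<ge>0. x ^ n * norm ((halfline_deriv ^^ 0) \<phi> x) \<le> B"
    using assms unfolding schwartz_halfline_def by blast
  then have "\<And>n. \<exists>B. \<forall>x\<ge>0. x ^ n * norm (\<phi> x) \<le> B"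
    by simp
  then obtain B0 B2 where B: "\<And>x. x \<ge> 0 \<Longrightarrow> x ^ 0 * norm (\<phi> x) \<le> B0"
      "\<And>x. x \<ge> 0 \<Longrightarrow> x ^ 2 * norm (\<phi> x) \<le> B2"
    by meson
  have "norm (\<phi> x) \<le> (B0 + B2) * inverse (1 + x\<^sup>2)" if "x \<ge> 0" for x
  proof -
    have "norm (\<phi> x) * (1 + x\<^sup>2) \<le> B0 + B2"
      using B[OF that] by (simp add: algebra_simps)
    moreover have "1 + x\<^sup>2 > 0"
      by (simp add: add_pos_nonneg)
    ultimately show ?thesis
      by (simp add: field_simps)
  qed
  then show ?thesis
    using that by blast
qed

lemma inverse_1_plus_square_integrable_halfline:
  "(\<lambda>x::real. inverse (1 + x\<^sup>2)) integrable_on {0..}"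
proof -
  have "set_integrable lborel {0..} (\<lambda>x::real. inverse (1 + x\<^sup>2))"
    using integrable_inverse_1_plus_square by (rule set_integrable_subset) auto
  then show ?thesis
    by (rule set_borel_integral_eq_integral(1))
qed

lemma schwartz_halfline_tendsto_0:
  assumes "\<phi> \<in> schwartz_halfline"
  shows "(\<phi> \<longlongrightarrow> 0) at_top"
proof -
  obtain B where B: "\<And>x. x \<ge> 0 \<Longrightarrow> norm (\<phi> x) \<le> B * inverse (1 + x\<^sup>2)"
    using schwartz_halfline_decay[OF assms] by blast
  have "((\<lambda>x::real. B * inverse (1 + x\<^sup>2)) \<longlongrightarrow> 0) at_top"
    by real_asymp
  then show ?thesis
    by (rule Lim_null_comparison[rotated])
       (use B in \<open>auto intro: eventually_mono[OF eventually_ge_at_top[of 0]]\<close>)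
qed

text \<open>All improper integrals below have a Schwartz function multiplied by a bounded kernel as integrand:
  an exponential or a sine integral.\<close>
lemma schwartz_halfline_mult_absolutely_integrable:
  fixes u :: "real \<Rightarrow> complex"
  assumes \<phi>: "\<phi> \<in> schwartz_halfline" and u: "continuous_on {0..} u"
    and C: "\<And>y. y \<ge> 0 \<Longrightarrow> norm (u y) \<le> C"
  shows "(\<lambda>y. u y * \<phi> y) absolutely_integrable_on {0..}"
proof -
  obtain B where B: "\<And>x. x \<ge> 0 \<Longrightarrow> norm (\<phi> x) \<le> B * inverse (1 + x\<^sup>2)"
    using schwartz_halfline_decay[OF \<phi>] by blast
  show ?thesis
  proof (rule measurable_bounded_by_integrable_imp_absolutely_integrable)
    show "(\<lambda>y. u y * \<phi> y) \<in> borel_measurable (lebesgue_on {0..})"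
      by (intro continuous_imp_measurable_on_sets_lebesgue continuous_intros u
            schwartz_halfline_continuous[OF \<phi>]) auto
    show "(\<lambda>y::real. C * (B * inverse (1 + y\<^sup>2))) integrable_on {0..}"
      by (intro integrable_on_cmult_left[where 'b = real, simplified]
            inverse_1_plus_square_integrable_halfline)
    show "norm (u y * \<phi> y) \<le> C * (B * inverse (1 + y\<^sup>2))" if "y \<in> {0..}" for y
      using that C[of y] B[of y] norm_ge_zero[of "u y"] order_trans[OF norm_ge_zero C[of y]]
      by (simp add: norm_mult mult_mono)
  qed auto
qed

lemma schwartz_halfline_absolutely_integrable:
  assumes "\<phi> \<in> schwartz_halfline"
  shows "\<phi> absolutely_integrable_on {0..}"
  using schwartz_halfline_mult_absolutely_integrable[OF assms, of "\<lambda>_. 1" 1] by simp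

section \<open>Truncation of integrals over the half-line\<close>

lemma integral_halfline_truncation:
  fixes f :: "real \<Rightarrow> 'a::euclidean_space"
  assumes f: "f absolutely_integrable_on {0..}"
  shows "(\<lambda>n::nat. integral {0..real n} f) \<longlonglongrightarrow> integral {0..} f"
proof -
  let ?f = "\<lambda>n y. if y \<in> {0..real n} then f y else 0"
  have "(\<lambda>n. integral {0..} (?f n)) \<longlonglongrightarrow> integral {0..} f"
  proof (rule dominated_convergence(2)[where h = "\<lambda>y. norm (f y)"])
    have "f integrable_on {0..real n}" for n
      using f by (metis absolutely_integrable_on_def atLeastatMost_subset_iff
          integrable_on_subinterval atLeastAtMost_iff atLeast_iff subsetI)
    then show "?f n integrable_on {0..}" for n
      by (subst integrable_restrict_Int) (simp add: Int_absorb2 subset_iff)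
    show "(\<lambda>y. norm (f y)) integrable_on {0..}"
      using f by (simp add: absolutely_integrable_on_def)
    show "(\<lambda>n. ?f n y) \<longlonglongrightarrow> f y" if "y \<in> {0..}" for y
    proof (rule tendsto_eventually)
      have "\<forall>\<^sub>F n in sequentially. y \<le> real n"
        using filterlim_real_sequentially by (simp add: filterlim_at_top)
      then show "\<forall>\<^sub>F n in sequentially. ?f n y = f y"
        by (rule eventually_mono) (use that in auto)
    qed
  qed auto
  then show ?thesis
    by (subst (asm) integral_restrict_Int) (simp add: Int_absorb2 subset_iff)
qed

text \<open>The bound does not depend on the multiplier \<open>u\<close>. This is what makes the convergence of the
  truncated Laplace integrals uniform in the spectral parameter.\<close>
lemma integral_halfline_tail_le:
  fixes u f :: "real \<Rightarrow> complex"
  assumes uf: "(\<lambda>y. u y * f y) absolutely_integrable_on {0..}"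
    and f: "f absolutely_integrable_on {0..}"
    and u: "\<And>y. y \<ge> 0 \<Longrightarrow> norm (u y) \<le> 1"
  shows "norm (integral {0..} (\<lambda>y. u y * f y) - integral {0..real n} (\<lambda>y. u y * f y))
           \<le> integral {0..} (\<lambda>y. norm (f y)) - integral {0..real n} (\<lambda>y. norm (f y))"
proof -
  have split: "g integrable_on {real n..} \<and>
      integral {0..} g - integral {0..real n} g = integral {real n..} g"
    if "g absolutely_integrable_on {0..}" for g :: "real \<Rightarrow> 'b::euclidean_space"
  proof -
    have "g absolutely_integrable_on {0..real n}" "g absolutely_integrable_on {real n..}"
      using that by (auto intro: set_integrable_subset)
    then have int: "g integrable_on {0..real n}" "g integrable_on {real n..}"
      by (auto simp: absolutely_integrable_on_def)
    have "{0..} = {0..real n} \<union> {real n..}" "{0..real n} \<inter> {real n..} = {real n}"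
      by auto
    then have "integral {0..} g = integral {0..real n} g + integral {real n..} g"
      using integral_Un[OF int] by simp
    with int show ?thesis by simp
  qed
  have nf: "(\<lambda>y. norm (f y)) absolutely_integrable_on {0..}"
    using absolutely_integrable_norm[OF f] by (simp add: o_def)
  have "norm (integral {real n..} (\<lambda>y. u y * f y)) \<le> integral {real n..} (\<lambda>y. norm (f y))"
    using split[OF uf] split[OF nf] u
    by (intro integral_norm_bound_integral) (auto simp: norm_mult mult_left_le_one_le)
  then show ?thesis
    using split[OF uf] split[OF nf] by simp
qed

section \<open>The Laplace transform on the closed right half-plane\<close>

text \<open>Both branches of the transform are values of one function: on the real axis \<open>s = \<i>\<lambda>\<close> lies on the
  boundary of the right half-plane, on the closed contour \<open>s = \<i> / \<lambda>\<close> lies in its interior.\<close>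
definition halfline_laplace :: "(real \<Rightarrow> complex) \<Rightarrow> complex \<Rightarrow> complex" where
  "halfline_laplace \<phi> s = integral {0..} (\<lambda>y. exp (- s * of_real y) * \<phi> y)"

lemma norm_laplace_kernel_le:
  "Re s \<ge> 0 \<Longrightarrow> y \<ge> 0 \<Longrightarrow> norm (exp (- s * of_real y)) \<le> 1"
  by (simp add: norm_exp_eq_Re)

lemma laplace_integrand_absolutely_integrable:
  assumes "\<phi> \<in> schwartz_halfline" "Re s \<ge> 0"
  shows "(\<lambda>y. exp (- s * of_real y) * \<phi> y) absolutely_integrable_on {0..}"
  by (rule schwartz_halfline_mult_absolutely_integrable[where C = 1])
     (use assms norm_laplace_kernel_le in \<open>auto intro!: continuous_intros\<close>)

lemma halfline_laplace_linear:
  assumes f: "f \<in> schwartz_halfline" and g: "g \<in> schwartz_halfline" and s: "Re s \<ge> 0"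
  shows "halfline_laplace (\<lambda>t. a * f t + b * g t) s
           = a * halfline_laplace f s + b * halfline_laplace g s"
proof -
  have "(\<lambda>y. exp (- s * of_real y) * f y) integrable_on {0..}"
    and "(\<lambda>y. exp (- s * of_real y) * g y) integrable_on {0..}"
    using laplace_integrand_absolutely_integrable s f g by (auto simp: absolutely_integrable_on_def)
  then have "((\<lambda>y. a * (exp (- s * of_real y) * f y) + b * (exp (- s * of_real y) * g y))
      has_integral (a * halfline_laplace f s + b * halfline_laplace g s)) {0..}"
    unfolding halfline_laplace_def
    by (intro has_integral_add has_integral_mult_right integrable_integral)
  then show ?thesis
    unfolding halfline_laplace_def by (intro integral_unique) (simp add: algebra_simps)
qed

text \<open>On the closed half-plane the kernel has modulus at most \<open>1\<close>, so the tails are bounded by those of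
  the integral of $|\phi|$. Uniformity up to the boundary carries continuity over to the imaginary axis
  and justifies exchanging limits with integrals over it; in the interior it carries over holomorphy.\<close>
lemma halfline_laplace_uniform_limit:
  assumes \<phi>: "\<phi> \<in> schwartz_halfline"
  shows "uniform_limit {s. Re s \<ge> 0}
           (\<lambda>n s. integral {0..real n} (\<lambda>y. exp (- s * of_real y) * \<phi> y))
           (halfline_laplace \<phi>) sequentially"
proof (rule uniform_limitI)
  fix e :: real assume "e > 0"
  have abs: "\<phi> absolutely_integrable_on {0..}"
    by (rule schwartz_halfline_absolutely_integrable[OF \<phi>])
  have "(\<lambda>n. integral {0..} (\<lambda>y. norm (\<phi> y)) - integral {0..real n} (\<lambda>y. norm (\<phi> y)))
          \<longlonglongrightarrow> integral {0..} (\<lambda>y. norm (\<phi> y)) - integral {0..} (\<lambda>y. norm (\<phi> y))"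
    using absolutely_integrable_norm[OF abs]
    by (intro tendsto_intros integral_halfline_truncation) (simp add: o_def)
  then have "\<forall>\<^sub>F n in sequentially.
      integral {0..} (\<lambda>y. norm (\<phi> y)) - integral {0..real n} (\<lambda>y. norm (\<phi> y)) < e"
    using \<open>e > 0\<close> by (intro order_tendstoD(2)) auto
  then show "\<forall>\<^sub>F n in sequentially. \<forall>s\<in>{s. Re s \<ge> 0}.
      dist (integral {0..real n} (\<lambda>y. exp (- s * of_real y) * \<phi> y)) (halfline_laplace \<phi> s) < e"
  proof (rule eventually_mono, intro ballI)
    fix n s
    assume n: "integral {0..} (\<lambda>y. norm (\<phi> y)) - integral {0..real n} (\<lambda>y. norm (\<phi> y)) < e"
      and s: "s \<in> {s. Re s \<ge> 0}"
    show "dist (integral {0..real n} (\<lambda>y. exp (- s * of_real y) * \<phi> y)) (halfline_laplace \<phi> s) < e"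
      using integral_halfline_tail_le[OF laplace_integrand_absolutely_integrable[OF \<phi>] abs, of s n]
        norm_laplace_kernel_le[of s] s n
      by (simp add: halfline_laplace_def dist_norm norm_minus_commute)
  qed
qed

lemma truncated_laplace_holomorphic:
  assumes \<phi>: "\<phi> \<in> schwartz_halfline"
  shows "(\<lambda>s. integral {0..real n} (\<lambda>y. exp (- s * of_real y) * \<phi> y)) holomorphic_on UNIV"
proof -
  have cont: "continuous_on {0..real n} \<phi>"
    using schwartz_halfline_continuous[OF \<phi>] by (rule continuous_on_subset) auto
  have "(\<lambda>s. integral (cbox 0 (real n)) (\<lambda>y. exp (- s * of_real y) * \<phi> y)) holomorphic_on UNIV"
  proof (rule leibniz_rule_holomorphic)
    show "((\<lambda>s. exp (- s * of_real t) * \<phi> t) has_field_derivative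
        (- of_real t * exp (- s * of_real t) * \<phi> t)) (at s within UNIV)" for s t
      by (auto intro!: derivative_eq_intros)
    show "(\<lambda>y. exp (- s * of_real y) * \<phi> y) integrable_on cbox 0 (real n)" for s
      by (intro integrable_continuous continuous_intros) (simp add: cont)
    show "continuous_on (UNIV \<times> cbox 0 (real n))
        (\<lambda>(s, t). - of_real t * exp (- s * of_real t) * \<phi> t)"
      unfolding case_prod_beta
      by (intro continuous_intros continuous_on_compose2[OF cont]) auto
  qed auto
  then show ?thesis by simp
qed

lemma halfline_laplace_continuous:
  assumes \<phi>: "\<phi> \<in> schwartz_halfline"
  shows "continuous_on {s. Re s \<ge> 0} (halfline_laplace \<phi>)"
proof (rule uniform_limit_theorem[OF _ halfline_laplace_uniform_limit[OF \<phi>]])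
  show "\<forall>\<^sub>F n in sequentially. continuous_on {s. Re s \<ge> 0}
      (\<lambda>s. integral {0..real n} (\<lambda>y. exp (- s * of_real y) * \<phi> y))"
    using holomorphic_on_imp_continuous_on[OF truncated_laplace_holomorphic[OF \<phi>]]
      continuous_on_subset by (intro always_eventually) blast
qed auto

lemma halfline_laplace_holomorphic:
  assumes \<phi>: "\<phi> \<in> schwartz_halfline"
  shows "halfline_laplace \<phi> holomorphic_on {s. Re s > 0}"
proof (rule holomorphic_uniform_sequence)
  show op: "open {s. Re s > 0}"
    by (rule open_halfspace_Re_gt)
  show "(\<lambda>s. integral {0..real n} (\<lambda>y. exp (- s * of_real y) * \<phi> y)) holomorphic_on {s. Re s > 0}" for n
    using truncated_laplace_holomorphic[OF \<phi>] by (rule holomorphic_on_subset) auto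
  fix z assume "z \<in> {s. Re s > 0}"
  then obtain d where d: "d > 0" "cball z d \<subseteq> {s. Re s > 0}"
    using op by (meson open_contains_cball)
  moreover have "uniform_limit (cball z d)
      (\<lambda>n s. integral {0..real n} (\<lambda>y. exp (- s * of_real y) * \<phi> y)) (halfline_laplace \<phi>) sequentially"
    by (rule uniform_limit_on_subset[OF halfline_laplace_uniform_limit[OF \<phi>]])
       (use d(2) in \<open>force simp: subset_iff\<close>)
  ultimately show "\<exists>d>0. cball z d \<subseteq> {s. Re s > 0} \<and> uniform_limit (cball z d)
      (\<lambda>n s. integral {0..real n} (\<lambda>y. exp (- s * of_real y) * \<phi> y)) (halfline_laplace \<phi>) sequentially"
    by blast
qed

section \<open>Fourier inversion on the half-line\<close>

lemma Si_odd: "Si (- t) = - Si t"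
  using Si_neg[of t] Si_neg[of "- t"] by (cases "t \<ge> 0") auto

text \<open>The factor \<open>X n\<close> makes the sine integral a smoothed step function. At \<open>c = 0\<close> the value \<open>Si 0 = 0\<close>
  agrees with \<open>sgn 0 = 0\<close>, so the limit holds without exception.\<close>
lemma Si_tendsto_sgn:
  assumes X: "filterlim X at_top F"
  shows "((\<lambda>n. Si (X n * c)) \<longlongrightarrow> sgn c * (pi / 2)) F"
proof -
  have pos: "((\<lambda>n. Si (X n * d)) \<longlongrightarrow> pi / 2) F" if "d > 0" for d
    by (rule filterlim_compose[OF Si_at_top])
       (use X that filterlim_at_top_mult_tendsto_pos[OF tendsto_const] in blast)
  consider "c > 0" | "c = 0" | "c < 0" by linarith
  then show ?thesis
  proof cases
    case 1
    then show ?thesis using pos by simp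
  next
    case 2
    then show ?thesis using Si_odd[of 0] by simp
  next
    case 3
    then show ?thesis
      using tendsto_minus[OF pos[of "- c"]] by (simp add: Si_odd)
  qed
qed

lemma has_integral_dirichlet_kernel:
  assumes "N \<ge> 0"
  shows "((\<lambda>l. exp (\<i> * of_real l * of_real u)) has_integral of_real (2 * N * sinc (N * u))) {-N..N}"
proof (cases "u = 0")
  case True
  then show ?thesis
    using has_integral_const_real[of "1 :: complex" "- N" N] assms by (simp add: scaleR_conv_of_real)
next
  case False
  have "((\<lambda>l. exp (\<i> * of_real l * of_real u)) has_integral
      exp (\<i> * of_real N * of_real u) / (\<i> * of_real u)
        - exp (\<i> * of_real (- N) * of_real u) / (\<i> * of_real u)) {-N..N}"
  proof (rule fundamental_theorem_of_calculus)
    fix l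
    have "((\<lambda>z. exp (\<i> * z * of_real u) / (\<i> * of_real u)) has_field_derivative
        exp (\<i> * of_real l * of_real u)) (at (of_real l))"
      using False by (auto intro!: derivative_eq_intros)
    then show "((\<lambda>l. exp (\<i> * of_real l * of_real u) / (\<i> * of_real u)) has_vector_derivative
        exp (\<i> * of_real l * of_real u)) (at l within {-N..N})"
      by (intro has_vector_derivative_real_field has_vector_derivative_at_within)
  qed (use assms in simp)
  also have "exp (\<i> * of_real N * of_real u) / (\<i> * of_real u)
        - exp (\<i> * of_real (- N) * of_real u) / (\<i> * of_real u) = of_real (2 * sin (N * u) / u)"
  proof -
    have "exp (\<i> * of_real N * of_real u) = cos (of_real N * of_real u) + \<i> * sin (of_real N * of_real u)"
      "exp (\<i> * of_real (- N) * of_real u) = cos (of_real N * of_real u) - \<i> * sin (of_real N * of_real u)"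
      using exp_Euler[of "of_real N * of_real u"] exp_minus_Euler[of "of_real N * of_real u"]
      by (simp_all add: mult.assoc)
    then show ?thesis
      using False by (simp only: sin_of_real[symmetric] of_real_mult of_real_divide of_real_numeral)
        (simp add: field_simps)
  qed
  also have "2 * sin (N * u) / u = 2 * N * sinc (N * u)"
    using False by (cases "N = 0") auto
  finally show ?thesis .
qed

text \<open>With both variables in compact intervals the integrand is continuous, so the order of integration
  can be exchanged; the inner integral is then the Dirichlet kernel.\<close>
lemma truncated_fourier_partial_integral:
  assumes \<phi>: "\<phi> \<in> schwartz_halfline" and N: "N \<ge> 0"
  shows "integral {-N..N} (\<lambda>l. exp (\<i> * of_real l * of_real x) *
             integral {0..real n} (\<lambda>y. exp (- (\<i> * of_real l) * of_real y) * \<phi> y))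
         = integral {0..real n} (\<lambda>y. \<phi> y * of_real (2 * N * sinc (N * (y - x))))"
proof -
  have cont: "continuous_on {0..real n} \<phi>"
    using schwartz_halfline_continuous[OF \<phi>] by (rule continuous_on_subset) auto
  let ?k = "\<lambda>l y. exp (\<i> * of_real l * of_real x) * (exp (- (\<i> * of_real l) * of_real y) * \<phi> y)"
  have "integral {-N..N} (\<lambda>l. integral {0..real n} (?k l))
          = integral {0..real n} (\<lambda>y. integral {-N..N} (\<lambda>l. ?k l y))"
  proof (rule integral_swap_continuous[where a = "- N" and b = N and c = 0 and d = "real n",
        unfolded cbox_interval])
    show "continuous_on {(- N, 0)..(N, real n)} (\<lambda>(l, y). ?k l y)"
      unfolding case_prod_beta
      by (intro continuous_intros continuous_on_compose2[OF cont]) auto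
  qed
  moreover have "integral {-N..N} (\<lambda>l. ?k l y) = \<phi> y * of_real (2 * N * sinc (N * (y - x)))" for y
  proof -
    have k: "?k l y = \<phi> y * exp (\<i> * of_real l * of_real (x - y))" for l
      by (simp add: algebra_simps flip: exp_add)
    have "integral {-N..N} (\<lambda>l. ?k l y) = \<phi> y * of_real (2 * N * sinc (N * (x - y)))"
      unfolding k by (intro integral_unique has_integral_mult_right has_integral_dirichlet_kernel N)
    also have "sinc (N * (x - y)) = sinc (N * (y - x))"
      using sinc_neg[of "N * (y - x)"] unfolding mult_minus_right[symmetric] minus_diff_eq
      by simp
    finally show ?thesis .
  qed
  ultimately show ?thesis
    by (simp del: of_real_mult)
qed

text \<open>The Dirichlet kernel is the derivative of \<open>2 Si(N(y - x))\<close>, a function bounded uniformly in \<open>N\<close>. The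
  boundary term at \<open>0\<close> changes sign because \<open>Si\<close> is odd.\<close>
lemma truncated_dirichlet_integral_by_parts:
  assumes \<phi>: "\<phi> \<in> schwartz_halfline"
  shows "integral {0..real n} (\<lambda>y. \<phi> y * of_real (2 * N * sinc (N * (y - x))))
         = \<phi> (real n) * of_real (2 * Si (N * (real n - x))) + \<phi> 0 * of_real (2 * Si (N * x))
           - integral {0..real n} (\<lambda>y. of_real (2 * Si (N * (y - x))) * halfline_deriv \<phi> y)"
proof -
  let ?S = "\<lambda>y. of_real (2 * Si (N * (y - x))) :: complex"
  let ?S' = "\<lambda>y. of_real (2 * N * sinc (N * (y - x))) :: complex"
  have S: "(?S has_vector_derivative ?S' y) (at y within A)" for y A
  proof -
    have "((\<lambda>y. 2 * Si (N * (y - x))) has_real_derivative 2 * N * sinc (N * (y - x))) (at y within A)"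
      by (rule derivative_eq_intros DERIV_chain2[OF DERIV_Si] refl | simp add: mult_ac)+
    then show ?thesis
      by (intro has_vector_derivative_of_real) (simp add: has_real_derivative_iff_has_vector_derivative)
  qed
  have "((\<lambda>y. ?S y * halfline_deriv \<phi> y + \<phi> y * ?S' y) has_integral
      \<phi> (real n) * ?S (real n) - \<phi> 0 * ?S 0) {0..real n}"
  proof (rule fundamental_theorem_of_calculus)
    fix y assume y: "y \<in> {0..real n}"
    have "(\<phi> has_vector_derivative halfline_deriv \<phi> y) (at y within {0..real n})"
      by (rule has_vector_derivative_within_subset[OF schwartz_halfline_has_derivative[OF \<phi>]])
         (use y in auto)
    from has_vector_derivative_mult[OF this S]
    show "((\<lambda>y. \<phi> y * ?S y) has_vector_derivative ?S y * halfline_deriv \<phi> y + \<phi> y * ?S' y)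
        (at y within {0..real n})"
      by (simp add: mult.commute add.commute)
  qed simp
  moreover have "(\<lambda>y. ?S y * halfline_deriv \<phi> y) integrable_on {0..real n}"
  proof (intro integrable_continuous_real continuous_intros)
    show "continuous_on {0..real n} (halfline_deriv \<phi>)"
      using schwartz_halfline_continuous[OF schwartz_halfline_deriv[OF \<phi>]]
      by (rule continuous_on_subset) auto
    show "continuous_on {0..real n} (\<lambda>y. Si (N * (y - x)))"
      by (intro continuous_at_imp_continuous_on ballI continuous_within_compose3[OF isCont_Si]
            continuous_intros)
  qed
  ultimately have "((\<lambda>y. (?S y * halfline_deriv \<phi> y + \<phi> y * ?S' y) - ?S y * halfline_deriv \<phi> y)
      has_integral (\<phi> (real n) * ?S (real n) - \<phi> 0 * ?S 0)
        - integral {0..real n} (\<lambda>y. ?S y * halfline_deriv \<phi> y)) {0..real n}"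
    by (intro has_integral_diff integrable_integral)
  then have "integral {0..real n} (\<lambda>y. \<phi> y * ?S' y) = \<phi> (real n) * ?S (real n) - \<phi> 0 * ?S 0
        - integral {0..real n} (\<lambda>y. ?S y * halfline_deriv \<phi> y)"
    by (intro integral_unique) (simp del: of_real_mult)
  moreover have "Si (N * (0 - x)) = - Si (N * x)"
    using Si_odd[of "N * x"] by simp
  ultimately show ?thesis
    by simp
qed

text \<open>Letting the truncation in \<open>y\<close> tend to infinity: the left side converges uniformly in the
  frequency, and on the right the boundary term disappears because \<open>\<phi>\<close> vanishes at infinity while
  \<open>Si\<close> is bounded.\<close>
lemma fourier_partial_integral_Si:
  assumes \<phi>: "\<phi> \<in> schwartz_halfline" and N: "N \<ge> 0"
  shows "integral {-N..N} (\<lambda>l. exp (\<i> * of_real l * of_real x) * halfline_laplace \<phi> (\<i> * of_real l))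
         = \<phi> 0 * of_real (2 * Si (N * x))
           - integral {0..} (\<lambda>y. of_real (2 * Si (N * (y - x))) * halfline_deriv \<phi> y)"
proof -
  obtain B where B: "\<And>t. \<bar>Si t\<bar> \<le> B"
    using bounded_Si by blast
  let ?H = "\<lambda>n s. integral {0..real n} (\<lambda>y. exp (- s * of_real y) * \<phi> y)"
  let ?S = "\<lambda>y. of_real (2 * Si (N * (y - x))) :: complex"
  let ?D = "\<lambda>n. integral {0..real n} (\<lambda>y. \<phi> y * of_real (2 * N * sinc (N * (y - x))))"
  have ul: "uniform_limit {-N..N} (\<lambda>n l. exp (\<i> * of_real l * of_real x) * ?H n (\<i> * of_real l))
      (\<lambda>l. exp (\<i> * of_real l * of_real x) * halfline_laplace \<phi> (\<i> * of_real l)) sequentially"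
  proof (rule uniform_limitI)
    fix e :: real assume "e > 0"
    \<comment> \<open>The oscillating factor has modulus \<open>1\<close>, so it does not affect the rate of convergence.\<close>
    have "dist (exp (\<i> * of_real l * of_real x) * u) (exp (\<i> * of_real l * of_real x) * v) = dist u v"
      for l u v
      by (simp add: dist_norm norm_mult norm_exp_eq_Re flip: right_diff_distrib)
    then show "\<forall>\<^sub>F n in sequentially. \<forall>l\<in>{-N..N}.
        dist (exp (\<i> * of_real l * of_real x) * ?H n (\<i> * of_real l))
             (exp (\<i> * of_real l * of_real x) * halfline_laplace \<phi> (\<i> * of_real l)) < e"
      using uniform_limitD[OF halfline_laplace_uniform_limit[OF \<phi>] \<open>e > 0\<close>]
      by (auto elim!: eventually_mono)
  qed
  have "continuous_on {-N..N} (\<lambda>l. exp (\<i> * of_real l * of_real x) * ?H n (\<i> * of_real l))" for n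
    by (intro continuous_intros continuous_on_compose2[OF
          holomorphic_on_imp_continuous_on[OF truncated_laplace_holomorphic[OF \<phi>]]]) auto
  from uniform_limit_integral[OF ul this] obtain I J where
    I: "\<And>n. ((\<lambda>l. exp (\<i> * of_real l * of_real x) * ?H n (\<i> * of_real l)) has_integral I n) {-N..N}"
    and J: "((\<lambda>l. exp (\<i> * of_real l * of_real x) * halfline_laplace \<phi> (\<i> * of_real l)) has_integral J) {-N..N}"
    and IJ: "I \<longlonglongrightarrow> J"
    by auto
  have "I = ?D"
    using integral_unique[OF I] truncated_fourier_partial_integral[OF \<phi> N] by auto
  with IJ have "?D \<longlonglongrightarrow> J" by simp
  moreover have "?D \<longlonglongrightarrow> 0 + \<phi> 0 * of_real (2 * Si (N * x))
           - integral {0..} (\<lambda>y. ?S y * halfline_deriv \<phi> y)"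
    unfolding truncated_dirichlet_integral_by_parts[OF \<phi>]
  proof (intro tendsto_intros integral_halfline_truncation)
    have "((\<lambda>n. \<phi> (real n)) \<longlongrightarrow> 0) sequentially"
      using schwartz_halfline_tendsto_0[OF \<phi>] filterlim_real_sequentially by (rule filterlim_compose)
    moreover have "\<forall>\<^sub>F n in sequentially. norm (?S (real n)) \<le> 2 * B"
      using B by (intro always_eventually) (simp add: norm_mult)
    ultimately show "(\<lambda>n. \<phi> (real n) * ?S (real n)) \<longlonglongrightarrow> 0"
      by (rule lim_null_mult_right_bounded)
    show "(\<lambda>y. ?S y * halfline_deriv \<phi> y) absolutely_integrable_on {0..}"
    proof (rule schwartz_halfline_mult_absolutely_integrable[OF schwartz_halfline_deriv[OF \<phi>]])
      show "continuous_on {0..} ?S"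
        by (intro continuous_intros continuous_at_imp_continuous_on ballI
              continuous_within_compose3[OF isCont_Si])
      show "norm (?S y) \<le> 2 * B" for y
        using B[of "N * (y - x)"] by (simp add: norm_mult)
    qed
  qed
  ultimately have "J = 0 + \<phi> 0 * of_real (2 * Si (N * x))
           - integral {0..} (\<lambda>y. ?S y * halfline_deriv \<phi> y)"
    by (rule LIMSEQ_unique)
  then show ?thesis
    using integral_unique[OF J] by simp
qed

text \<open>By the fundamental theorem \<open>\<phi>'\<close> has integral \<open>- \<phi> 0\<close> over the half-line and \<open>\<phi> x - \<phi> 0\<close> over
  the segment from \<open>0\<close> to \<open>x\<close>. Multiplying by the sign means subtracting the latter twice.\<close>
lemma has_integral_sgn_halfline_deriv:
  assumes \<phi>: "\<phi> \<in> schwartz_halfline" and x: "x \<ge> 0"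
  shows "((\<lambda>y. of_real (sgn (y - x)) * halfline_deriv \<phi> y) has_integral \<phi> 0 - 2 * \<phi> x) {0..}"
proof -
  let ?d = "halfline_deriv \<phi>"
  have ftc: "(?d has_integral \<phi> b - \<phi> a) {a..b}" if "0 \<le> a" "a \<le> b" for a b
    by (rule fundamental_theorem_of_calculus[OF that(2)],
        rule has_vector_derivative_within_subset[OF schwartz_halfline_has_derivative[OF \<phi>]])
       (use that in auto)
  have abs: "?d absolutely_integrable_on {0..}"
    by (intro schwartz_halfline_absolutely_integrable schwartz_halfline_deriv \<phi>)
  have "(\<lambda>n. integral {0..real n} ?d) \<longlonglongrightarrow> integral {0..} ?d"
    by (rule integral_halfline_truncation[OF abs])
  moreover have "(\<lambda>n. integral {0..real n} ?d) \<longlonglongrightarrow> 0 - \<phi> 0"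
  proof -
    have "(\<lambda>n. \<phi> (real n) - \<phi> 0) \<longlonglongrightarrow> 0 - \<phi> 0"
      by (intro tendsto_diff tendsto_const
            filterlim_compose[OF schwartz_halfline_tendsto_0[OF \<phi>] filterlim_real_sequentially])
    moreover have "integral {0..real n} ?d = \<phi> (real n) - \<phi> 0" for n
      using ftc[of 0 "real n"] by (intro integral_unique) simp
    ultimately show ?thesis by simp
  qed
  ultimately have "integral {0..} ?d = - \<phi> 0"
    using LIMSEQ_unique by fastforce
  then have total: "(?d has_integral - \<phi> 0) {0..}"
    using abs by (metis absolutely_integrable_on_def integrable_integral)
  have "((\<lambda>y. if y \<in> {0..x} then ?d y else 0) has_integral \<phi> x - \<phi> 0) {0..}"
    using ftc[of 0 x] x by (subst has_integral_restrict) auto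
  from has_integral_diff[OF total has_integral_mult_right[OF this, of 2]]
  have "((\<lambda>y. ?d y - 2 * (if y \<in> {0..x} then ?d y else 0)) has_integral \<phi> 0 - 2 * \<phi> x) {0..}"
    by (simp add: algebra_simps)
  \<comment> \<open>The two integrands differ only at the point \<open>y = x\<close>, where the sign is \<open>0\<close>.\<close>
  then show ?thesis
    by (rule has_integral_spike[of "{x}", rotated 2]) (auto simp: sgn_if)
qed

text \<open>The representation by sine integrals admits dominated convergence. The two occurrences of
  \<open>\<phi> 0\<close> cancel because \<open>Si(Nx)\<close> also tends to \<open>\<pi>/2\<close>; this is where \<open>x > 0\<close> enters.\<close>
lemma fourier_inversion_halfline:
  assumes \<phi>: "\<phi> \<in> schwartz_halfline" and x: "x > 0"
  shows "((\<lambda>N. integral {-N..N} (\<lambda>l. exp (\<i> * of_real l * of_real x) * halfline_laplace \<phi> (\<i> * of_real l)))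
           \<longlongrightarrow> 2 * of_real pi * \<phi> x) at_top"
proof (rule tendsto_at_topI_sequentially)
  fix X :: "nat \<Rightarrow> real" assume X: "filterlim X at_top sequentially"
  obtain B where B: "\<And>t. \<bar>Si t\<bar> \<le> B"
    using bounded_Si by blast
  let ?d = "halfline_deriv \<phi>"
  let ?S = "\<lambda>n y. of_real (2 * Si (X n * (y - x))) :: complex"
  have dS: "\<phi> \<in> schwartz_halfline" "?d \<in> schwartz_halfline"
    using \<phi> schwartz_halfline_deriv by auto
  have "(\<lambda>n. integral {0..} (\<lambda>y. ?S n y * ?d y)) \<longlonglongrightarrow>
      integral {0..} (\<lambda>y. of_real (2 * (sgn (y - x) * (pi / 2))) * ?d y)"
  proof (rule dominated_convergence(2)[where h = "\<lambda>y. (2 * B) * norm (?d y)"])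
    have cont: "continuous_on {0..} (?S n)" for n
      by (intro continuous_intros continuous_at_imp_continuous_on ballI
            continuous_within_compose3[OF isCont_Si])
    have bd: "norm (?S n y) \<le> 2 * B" for n y
      using B[of "X n * (y - x)"] by (simp add: norm_mult)
    show "(\<lambda>y. ?S n y * ?d y) integrable_on {0..}" for n
      using schwartz_halfline_mult_absolutely_integrable[OF dS(2) cont bd]
      by (simp add: absolutely_integrable_on_def)
    show "(\<lambda>y. 2 * B * norm (?d y)) integrable_on {0..}"
      using schwartz_halfline_absolutely_integrable[OF dS(2)]
      by (intro integrable_on_cmult_left[where 'b = real, simplified])
         (simp add: absolutely_integrable_on_def)
    show "norm (?S n y * ?d y) \<le> 2 * B * norm (?d y)" for n y
      unfolding norm_mult by (intro mult_right_mono) (use bd in auto)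
    show "(\<lambda>n. ?S n y * ?d y) \<longlonglongrightarrow> of_real (2 * (sgn (y - x) * (pi / 2))) * ?d y" for y
      by (intro tendsto_intros Si_tendsto_sgn X)
  qed
  also have "integral {0..} (\<lambda>y. of_real (2 * (sgn (y - x) * (pi / 2))) * ?d y)
      = of_real pi * (\<phi> 0 - 2 * \<phi> x)"
    using has_integral_mult_right[OF has_integral_sgn_halfline_deriv[OF \<phi>, of x], of "of_real pi"] x
    by (intro integral_unique) (simp add: mult_ac)
  finally have "(\<lambda>n. \<phi> 0 * of_real (2 * Si (X n * x)) - integral {0..} (\<lambda>y. ?S n y * ?d y)) \<longlonglongrightarrow>
      \<phi> 0 * of_real (2 * (sgn x * (pi / 2))) - of_real pi * (\<phi> 0 - 2 * \<phi> x)"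
    by (intro tendsto_diff tendsto_mult tendsto_const tendsto_of_real Si_tendsto_sgn X)
  also have "\<phi> 0 * of_real (2 * (sgn x * (pi / 2))) - of_real pi * (\<phi> 0 - 2 * \<phi> x)
      = 2 * of_real pi * \<phi> x"
    using x by (simp add: algebra_simps)
  finally show "(\<lambda>n. integral {- X n..X n}
      (\<lambda>l. exp (\<i> * of_real l * of_real x) * halfline_laplace \<phi> (\<i> * of_real l)))
      \<longlonglongrightarrow> 2 * of_real pi * \<phi> x"
  proof (rule Lim_transform_eventually)
    have "\<forall>\<^sub>F n in sequentially. X n \<ge> 0"
      using X by (simp add: filterlim_at_top)
    then show "\<forall>\<^sub>F n in sequentially.
        \<phi> 0 * of_real (2 * Si (X n * x)) - integral {0..} (\<lambda>y. ?S n y * ?d y) =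
        integral {- X n..X n} (\<lambda>l. exp (\<i> * of_real l * of_real x) * halfline_laplace \<phi> (\<i> * of_real l))"
      by (rule eventually_mono) (simp only: fourier_partial_integral_Si[OF \<phi>])
  qed
qed

section \<open>The transform pair\<close>

lemma F_transform_real:
  "F_transform \<gamma> \<phi> (of_real l) = halfline_laplace \<phi> (\<i> * of_real l)"
  by (simp add: F_transform_def halfline_laplace_def)

lemma F_transform_contour:
  assumes "path_image \<gamma> \<subseteq> {z. Im z > 0}" "z \<in> path_image \<gamma>"
  shows "F_transform \<gamma> \<phi> z = - (1 / z\<^sup>2) * halfline_laplace \<phi> (\<i> / z)"
proof -
  have "z \<notin> \<real>"
    using assms by (auto simp: complex_is_Real_iff)
  then show ?thesis
    using assms(2) by (simp add: F_transform_def halfline_laplace_def)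
qed

lemma Re_ii_divide_pos: "Im z > 0 \<Longrightarrow> Re (\<i> / z) > 0"
  by (cases z) (auto simp: Re_divide sum_power2_gt_zero_iff)

lemma F_transform_linear:
  assumes \<gamma>: "path_image \<gamma> \<subseteq> {z. Im z > 0}"
  shows "complex_linear_on schwartz_halfline (\<real> \<union> path_image \<gamma>) (F_transform \<gamma>)"
  unfolding complex_linear_on_def
proof (intro conjI ballI allI)
  fix f g a b z
  assume f: "f \<in> schwartz_halfline" and g: "g \<in> schwartz_halfline"
    and z: "z \<in> \<real> \<union> path_image \<gamma>"
  note lin = halfline_laplace_linear[OF f g]
  consider l where "z = of_real l" | "z \<in> path_image \<gamma>"
    using z by (auto elim: Reals_cases)
  then show "F_transform \<gamma> (\<lambda>t. a * f t + b * g t) z = a * F_transform \<gamma> f z + b * F_transform \<gamma> g z"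
  proof cases
    case 1
    then show ?thesis by (simp add: F_transform_real lin)
  next
    case 2
    then have "Re (\<i> / z) \<ge> 0"
      using \<gamma> Re_ii_divide_pos by force
    then show ?thesis
      unfolding F_transform_contour[OF \<gamma> 2] lin[OF \<open>Re (\<i> / z) \<ge> 0\<close>]
      by (simp add: algebra_simps)
  qed
qed (use schwartz_halfline_zero schwartz_halfline_linear in auto)

lemma F_inverse_linear: "complex_linear_on (F_inverse_domain \<gamma> x) {x} (F_inverse \<gamma>)"
  unfolding complex_linear_on_def
proof (intro conjI ballI allI)
  show "(\<lambda>t. 0) \<in> F_inverse_domain \<gamma> x"
    by (auto simp: F_inverse_domain_def contour_integrable_on_def intro: has_contour_integral_0)
next
  fix f g a b
  assume f: "f \<in> F_inverse_domain \<gamma> x" and g: "g \<in> F_inverse_domain \<gamma> x"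
  let ?e = "\<lambda>l::real. exp (\<i> * of_real l * of_real x)"
  let ?E = "\<lambda>z. exp (\<i> * z * of_real x)"
  let ?h = "\<lambda>t. a * f t + b * g t"
  have int: "\<And>N. (\<lambda>l. ?e l * f (of_real l)) integrable_on {-N..N}"
    "\<And>N. (\<lambda>l. ?e l * g (of_real l)) integrable_on {-N..N}"
    and con: "(\<lambda>z. ?E z * f z) contour_integrable_on \<gamma>" "(\<lambda>z. ?E z * g z) contour_integrable_on \<gamma>"
    using f g by (auto simp: F_inverse_domain_def)
  obtain L M where L: "((\<lambda>N. integral {-N..N} (\<lambda>l. ?e l * f (of_real l))) \<longlongrightarrow> L) at_top"
    and M: "((\<lambda>N. integral {-N..N} (\<lambda>l. ?e l * g (of_real l))) \<longlongrightarrow> M) at_top"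
    using f g by (auto simp: F_inverse_domain_def)
  have split: "(\<lambda>l. ?e l * ?h (of_real l))
      = (\<lambda>l. a * (?e l * f (of_real l)) + b * (?e l * g (of_real l)))"
    "(\<lambda>z. ?E z * ?h z) = (\<lambda>z. a * (?E z * f z) + b * (?E z * g z))"
    by (auto simp: algebra_simps)
  have hint: "((\<lambda>l. ?e l * ?h (of_real l)) has_integral
      a * integral {-N..N} (\<lambda>l. ?e l * f (of_real l)) + b * integral {-N..N} (\<lambda>l. ?e l * g (of_real l)))
      {-N..N}" for N
    unfolding split by (intro has_integral_add has_integral_mult_right integrable_integral int)
  have "((\<lambda>N. integral {-N..N} (\<lambda>l. ?e l * ?h (of_real l))) \<longlongrightarrow> a * L + b * M) at_top"
    unfolding integral_unique[OF hint] by (intro tendsto_intros L M)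
  note lims = this L M
  have hcon: "((\<lambda>z. ?E z * ?h z) has_contour_integral
      a * contour_integral \<gamma> (\<lambda>z. ?E z * f z) + b * contour_integral \<gamma> (\<lambda>z. ?E z * g z)) \<gamma>"
    unfolding split
    by (intro has_contour_integral_add has_contour_integral_lmul has_contour_integral_integral con)
  show "?h \<in> F_inverse_domain \<gamma> x"
    unfolding F_inverse_domain_def
    using hint lims(1) hcon by (auto simp: contour_integrable_on_def)
  fix y assume "y \<in> {x}"
  then have y: "y = x" by simp
  have Lims: "Lim at_top (\<lambda>N. integral {-N..N} (\<lambda>l. ?e l * ?h (of_real l))) = a * L + b * M"
    "Lim at_top (\<lambda>N. integral {-N..N} (\<lambda>l. ?e l * f (of_real l))) = L"
    "Lim at_top (\<lambda>N. integral {-N..N} (\<lambda>l. ?e l * g (of_real l))) = M"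
    using lims by (auto intro: tendsto_Lim)
  show "F_inverse \<gamma> ?h y = a * F_inverse \<gamma> f y + b * F_inverse \<gamma> g y"
    unfolding y F_inverse_def Lims contour_integral_unique[OF hcon] by (simp add: algebra_simps)
qed

text \<open>The singularity of \<open>1 / z\<^sup>2\<close> and \<open>\<i> / z\<close> at \<open>0\<close> lies outside the open upper half-plane, so Cauchy's
  theorem for convex sets applies to any closed curve there.\<close>
lemma contour_part_vanishes:
  assumes \<phi>: "\<phi> \<in> schwartz_halfline" and \<gamma>: "valid_path \<gamma>" "pathfinish \<gamma> = pathstart \<gamma>"
    and up: "path_image \<gamma> \<subseteq> {z. Im z > 0}"
  shows "((\<lambda>z. exp (\<i> * z * of_real x) * F_transform \<gamma> \<phi> z) has_contour_integral 0) \<gamma>"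
proof -
  let ?g = "\<lambda>z. exp (\<i> * z * of_real x) * (- (1 / z\<^sup>2) * halfline_laplace \<phi> (\<i> / z))"
  have "(halfline_laplace \<phi> \<circ> (\<lambda>z. \<i> / z)) holomorphic_on {z. Im z > 0}"
    by (rule holomorphic_on_compose_gen[OF _ halfline_laplace_holomorphic[OF \<phi>]])
       (auto intro!: holomorphic_intros Re_ii_divide_pos)
  then have "(\<lambda>z. halfline_laplace \<phi> (\<i> / z)) holomorphic_on {z. Im z > 0}"
    by (simp add: o_def)
  then have "?g holomorphic_on {z. Im z > 0}"
    by (intro holomorphic_intros) auto
  then have "(?g has_contour_integral 0) \<gamma>"
    by (rule Cauchy_theorem_convex_simple) (use \<gamma> up convex_halfspace_Im_gt in auto)
  then show ?thesis
    by (rule has_contour_integral_eq) (simp add: F_transform_contour[OF up])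
qed

lemma F_inversion:
  assumes \<phi>: "\<phi> \<in> schwartz_halfline" and x: "x > 0"
    and \<gamma>: "valid_path \<gamma>" "pathfinish \<gamma> = pathstart \<gamma>" "path_image \<gamma> \<subseteq> {z. Im z > 0}"
  shows "F_transform \<gamma> \<phi> \<in> F_inverse_domain \<gamma> x" "F_inverse \<gamma> (F_transform \<gamma> \<phi>) x = \<phi> x"
proof -
  have "continuous_on {-N..N} (\<lambda>l. halfline_laplace \<phi> (\<i> * of_real l))" for N
    by (rule continuous_on_compose2[OF halfline_laplace_continuous[OF \<phi>]])
       (auto intro!: continuous_intros)
  then have int: "(\<lambda>l. exp (\<i> * of_real l * of_real x) * halfline_laplace \<phi> (\<i> * of_real l))
      integrable_on {-N..N}" for N
    by (intro integrable_continuous_real continuous_intros)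
  note lim = fourier_inversion_halfline[OF \<phi> x]
  note con = contour_part_vanishes[OF \<phi> \<gamma>, of x]
  show "F_transform \<gamma> \<phi> \<in> F_inverse_domain \<gamma> x"
    using int lim con by (auto simp: F_inverse_domain_def F_transform_real contour_integrable_on_def)
  have "Lim at_top (\<lambda>N. integral {-N..N}
      (\<lambda>l. exp (\<i> * of_real l * of_real x) * halfline_laplace \<phi> (\<i> * of_real l))) = 2 * of_real pi * \<phi> x"
    using lim by (intro tendsto_Lim) auto
  then show "F_inverse \<gamma> (F_transform \<gamma> \<phi>) x = \<phi> x"
    unfolding F_inverse_def F_transform_real contour_integral_unique[OF con] by simp
qed

theorem proposition7:
  fixes \<gamma> :: "real \<Rightarrow> complex"
  assumes "admissible_contour \<gamma>"
  shows "complex_linear_on schwartz_halfline (\<real> \<union> path_image \<gamma>) (F_transform \<gamma>) \<and>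
         (\<forall>x::real. complex_linear_on (F_inverse_domain \<gamma> x) {x} (F_inverse \<gamma>)) \<and>
         (\<forall>\<phi>\<in>schwartz_halfline. \<forall>x>0.
            F_transform \<gamma> \<phi> \<in> F_inverse_domain \<gamma> x \<and>
            F_inverse \<gamma> (F_transform \<gamma> \<phi>) x = \<phi> x)"
proof -
  have \<gamma>: "valid_path \<gamma>" "pathfinish \<gamma> = pathstart \<gamma>" "path_image \<gamma> \<subseteq> {z. Im z > 0}"
    using assms unfolding admissible_contour_def by auto
  show ?thesis
    using F_transform_linear[OF \<gamma>(3)] F_inverse_linear F_inversion[OF _ _ \<gamma>] by blast
qed

end
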